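(* Let $R$ be an associative ring with identity and let $M$ be a left $R$-module. The following are equivalent: (1) $M$ is regular, i.e. for every $m\in M$ there exists $q\in M^*$ with $m=(mq)m$. (2) $M$ is J-torsionless and for every $m\in M$ there is an idempotent $e\in R$ such that $mM^*=eR$. (3) $M$ is torsionless and for every $m\in M$ there is an idempotent $e\in R$ such that $mM^*=eR$.
   Context: Homomorphisms of left modules are written on the right: $mq$ is the image of $m$ under $q$. $M^*=\mathrm{Hom}_R(M,R)$ is the set of left $R$-module homomorphisms $M\to R$, a right $R$-module via $m(qr)=(mq)r$. For $m\in M$, $mM^*=\{mq : q\in M^*\}$, a right ideal of $R$. $J(R)$ is the Jacobson radical of $R$. $M$ is torsionless if for every $0\ne m\in M$ there is $q\in M^*$ with $mq\neq 0$. $M$ is J-torsionless if $\{m\in M : mM^*\subseteq J(R)\}=0$, i.e. for every $0\neq m\in M$ there is $q\in M^*$ with $mq\notin J(R)$. *)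

theory Defs
  imports "HOL-Algebra.Module" "HOL-Algebra.Ideal"
begin

text \<open>The library's \<^locale>\<open>module\<close> requires a commutative ring of scalars; the axioms below are the
  same ones over an arbitrary \<^locale>\<open>ring\<close> (associative, with identity, possibly the zero ring).\<close>

locale left_module = R?: ring R + M?: abelian_group M
  for R :: "('a, 'r) ring_scheme" (structure)
  and M :: "('a, 'b, 'm) module_scheme" (structure) +
  assumes smult_closed:
      "\<lbrakk>a \<in> carrier R; x \<in> carrier M\<rbrakk> \<Longrightarrow> a \<odot>\<^bsub>M\<^esub> x \<in> carrier M"
    and smult_l_distr:
      "\<lbrakk>a \<in> carrier R; b \<in> carrier R; x \<in> carrier M\<rbrakk> \<Longrightarrow>
        (a \<oplus>\<^bsub>R\<^esub> b) \<odot>\<^bsub>M\<^esub> x = a \<odot>\<^bsub>M\<^esub> x \<oplus>\<^bsub>M\<^esub> b \<odot>\<^bsub>M\<^esub> x"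
    and smult_r_distr:
      "\<lbrakk>a \<in> carrier R; x \<in> carrier M; y \<in> carrier M\<rbrakk> \<Longrightarrow>
        a \<odot>\<^bsub>M\<^esub> (x \<oplus>\<^bsub>M\<^esub> y) = a \<odot>\<^bsub>M\<^esub> x \<oplus>\<^bsub>M\<^esub> a \<odot>\<^bsub>M\<^esub> y"
    and smult_assoc:
      "\<lbrakk>a \<in> carrier R; b \<in> carrier R; x \<in> carrier M\<rbrakk> \<Longrightarrow>
        (a \<otimes>\<^bsub>R\<^esub> b) \<odot>\<^bsub>M\<^esub> x = a \<odot>\<^bsub>M\<^esub> (b \<odot>\<^bsub>M\<^esub> x)"
    and smult_one:
      "x \<in> carrier M \<Longrightarrow> \<one>\<^bsub>R\<^esub> \<odot>\<^bsub>M\<^esub> x = x"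

definition left_ideal :: "'a set \<Rightarrow> ('a, 'r) ring_scheme \<Rightarrow> bool"
  where "left_ideal I R \<longleftrightarrow>
    additive_subgroup I R \<and> (\<forall>r\<in>carrier R. \<forall>x\<in>I. r \<otimes>\<^bsub>R\<^esub> x \<in> I)"

definition maximal_left_ideal :: "'a set \<Rightarrow> ('a, 'r) ring_scheme \<Rightarrow> bool"
  where "maximal_left_ideal I R \<longleftrightarrow>
    left_ideal I R \<and> I \<noteq> carrier R \<and>
    (\<forall>K. left_ideal K R \<and> I \<subseteq> K \<longrightarrow> K = I \<or> K = carrier R)"

text \<open>Intersection of all maximal left ideals; the whole ring if there are none, i.e. if \<open>R = 0\<close>.\<close>

definition jacobson_radical :: "('a, 'r) ring_scheme \<Rightarrow> 'a set"
  where "jacobson_radical R = {r \<in> carrier R. \<forall>I. maximal_left_ideal I R \<longrightarrow> r \<in> I}"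

text \<open>\<open>M\<^sup>* = Hom\<^sub>R(M, R)\<close>. As for the library's \<^const>\<open>hom\<close>, values outside \<open>carrier M\<close> are
  unconstrained. Homomorphisms written on the right become ordinary application: \<open>mq\<close> is \<open>q m\<close>.\<close>

definition module_dual :: "('a, 'r) ring_scheme \<Rightarrow> ('a, 'b, 'm) module_scheme \<Rightarrow> ('b \<Rightarrow> 'a) set"
  where "module_dual R M =
    {q \<in> hom (add_monoid M) (add_monoid R).
      \<forall>r\<in>carrier R. \<forall>m\<in>carrier M. q (r \<odot>\<^bsub>M\<^esub> m) = r \<otimes>\<^bsub>R\<^esub> q m}"

text \<open>The right ideal \<open>mM\<^sup>*\<close>.\<close>

definition dual_values :: "('a, 'r) ring_scheme \<Rightarrow> ('a, 'b, 'm) module_scheme \<Rightarrow> 'b \<Rightarrow> 'a set"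
  where "dual_values R M m = {q m | q. q \<in> module_dual R M}"

definition regular_module :: "('a, 'r) ring_scheme \<Rightarrow> ('a, 'b, 'm) module_scheme \<Rightarrow> bool"
  where "regular_module R M \<longleftrightarrow>
    (\<forall>m\<in>carrier M. \<exists>q\<in>module_dual R M. m = q m \<odot>\<^bsub>M\<^esub> m)"

definition torsionless :: "('a, 'r) ring_scheme \<Rightarrow> ('a, 'b, 'm) module_scheme \<Rightarrow> bool"
  where "torsionless R M \<longleftrightarrow>
    (\<forall>m\<in>carrier M. m \<noteq> \<zero>\<^bsub>M\<^esub> \<longrightarrow> (\<exists>q\<in>module_dual R M. q m \<noteq> \<zero>\<^bsub>R\<^esub>))"

definition J_torsionless :: "('a, 'r) ring_scheme \<Rightarrow> ('a, 'b, 'm) module_scheme \<Rightarrow> bool"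
  where "J_torsionless R M \<longleftrightarrow>
    {m \<in> carrier M. dual_values R M m \<subseteq> jacobson_radical R} = {\<zero>\<^bsub>M\<^esub>}"

definition idempotent_elem :: "('a, 'r) ring_scheme \<Rightarrow> 'a \<Rightarrow> bool"
  where "idempotent_elem R e \<longleftrightarrow> e \<in> carrier R \<and> e \<otimes>\<^bsub>R\<^esub> e = e"

end

theory Submission
  imports Defs
begin

text \<open>If \<open>m = (mq)m\<close>, then \<open>e = mq\<close> is idempotent with \<open>mM\<^sup>* = eR\<close>, and \<open>mM\<^sup>* \<subseteq> J(R)\<close> forces
  \<open>e = 0\<close>, since the only idempotent of \<open>J(R)\<close> is \<open>0\<close>; then \<open>m = em = 0\<close>. Conversely, if
  \<open>mM\<^sup>* = eR\<close> and \<open>e = mq\<close>, then \<open>mp = e(mp) = ((mq)m)p\<close> for every \<open>p\<close>, so that every functional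
  vanishes on \<open>m - (mq)m\<close>.\<close>

section \<open>Left ideals and maximal left ideals\<close>

lemma left_idealI:
  assumes "ring R" and sub: "I \<subseteq> carrier R" and zero: "\<zero>\<^bsub>R\<^esub> \<in> I"
    and add: "\<And>x y. \<lbrakk>x \<in> I; y \<in> I\<rbrakk> \<Longrightarrow> x \<oplus>\<^bsub>R\<^esub> y \<in> I"
    and mult: "\<And>r x. \<lbrakk>r \<in> carrier R; x \<in> I\<rbrakk> \<Longrightarrow> r \<otimes>\<^bsub>R\<^esub> x \<in> I"
  shows "left_ideal I R"
proof -
  interpret ring R by fact
  have minus: "\<ominus>\<^bsub>R\<^esub> x \<in> I" if "x \<in> I" for x
  proof -
    \<comment> \<open>Closure under negation follows from absorption, applied to the scalar
      -1.\<close>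
    have "\<ominus>\<^bsub>R\<^esub> x = (\<ominus>\<^bsub>R\<^esub> \<one>\<^bsub>R\<^esub>) \<otimes>\<^bsub>R\<^esub> x"
      using that sub by (auto simp: l_minus)
    then show ?thesis using mult that by simp
  qed
  have "additive_subgroup I R"
    by (intro additive_subgroup.intro add.subgroupI) (use sub zero add minus in auto)
  then show ?thesis using mult by (simp add: left_ideal_def)
qed

lemma left_ideal_subset: "left_ideal I R \<Longrightarrow> I \<subseteq> carrier R"
  by (simp add: left_ideal_def additive_subgroup.a_subset)

lemma left_ideal_zero_mem: "left_ideal I R \<Longrightarrow> \<zero>\<^bsub>R\<^esub> \<in> I"
  by (simp add: left_ideal_def additive_subgroup.zero_closed)

lemma left_ideal_add_mem: "\<lbrakk>left_ideal I R; x \<in> I; y \<in> I\<rbrakk> \<Longrightarrow> x \<oplus>\<^bsub>R\<^esub> y \<in> I"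
  by (simp add: left_ideal_def additive_subgroup.a_closed)

lemma left_ideal_mult_mem:
  "\<lbrakk>left_ideal I R; r \<in> carrier R; x \<in> I\<rbrakk> \<Longrightarrow> r \<otimes>\<^bsub>R\<^esub> x \<in> I"
  by (simp add: left_ideal_def)

text \<open>Absorption applied to \<open>r = r \<otimes> \<one>\<close>. It turns properness into
  omission of the identity, a condition that passes to unions.\<close>

lemma left_ideal_eq_carrier_iff:
  assumes "ring R" "left_ideal I R"
  shows "I = carrier R \<longleftrightarrow> \<one>\<^bsub>R\<^esub> \<in> I"
proof -
  interpret ring R by fact
  have "x \<in> I" if "\<one>\<^bsub>R\<^esub> \<in> I" "x \<in> carrier R" for x
    using left_ideal_mult_mem[OF assms(2) that(2) that(1)] that(2) by simp
  then show ?thesis using left_ideal_subset[OF assms(2)] by auto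
qed

text \<open>Two elements of the union already lie together in one member, the larger of the two that
  contain them; this is where the chain condition enters. It supplies the upper bounds for Zorn's
  lemma.\<close>

lemma left_ideal_Union_chain:
  assumes "ring R" and chain: "subset.chain A C" and ne: "C \<noteq> {}"
    and A: "\<And>I. I \<in> A \<Longrightarrow> left_ideal I R"
  shows "left_ideal (\<Union>C) R"
proof (rule left_idealI[OF assms(1)])
  have CA: "left_ideal I R" if "I \<in> C" for I
    using that chain A by (auto simp: subset_chain_def)
  show "\<Union>C \<subseteq> carrier R" using CA left_ideal_subset by blast
  show "\<zero>\<^bsub>R\<^esub> \<in> \<Union>C" using CA ne left_ideal_zero_mem by blast
  show "r \<otimes>\<^bsub>R\<^esub> x \<in> \<Union>C" if r: "r \<in> carrier R" and x: "x \<in> \<Union>C" for r x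
  proof -
    obtain I where "I \<in> C" "x \<in> I" using x by blast
    then show ?thesis using left_ideal_mult_mem[OF CA r] by blast
  qed
  show "x \<oplus>\<^bsub>R\<^esub> y \<in> \<Union>C" if xy: "x \<in> \<Union>C" "y \<in> \<Union>C" for x y
  proof -
    obtain I K where IK: "I \<in> C" "x \<in> I" "K \<in> C" "y \<in> K" using xy by blast
    then have "I \<subseteq> K \<or> K \<subseteq> I" using chain by (auto simp: subset_chain_def)
    then show ?thesis
    proof
      assume "I \<subseteq> K"
      then show ?thesis using IK left_ideal_add_mem[OF CA[of K]] by blast
    next
      assume "K \<subseteq> I"
      then show ?thesis using IK left_ideal_add_mem[OF CA[of I]] by blast
    qed
  qed
qed

lemma ex_maximal_left_ideal:
  assumes "ring R" and I: "left_ideal I R" and proper: "I \<noteq> carrier R"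
  obtains K where "maximal_left_ideal K R" "I \<subseteq> K"
proof -
  let ?A = "{K. left_ideal K R \<and> I \<subseteq> K \<and> \<one>\<^bsub>R\<^esub> \<notin> K}"
  have "\<exists>K\<in>?A. \<forall>L\<in>?A. K \<subseteq> L \<longrightarrow> L = K"
  proof (rule subset_Zorn_nonempty)
    show "?A \<noteq> {}" using assms left_ideal_eq_carrier_iff by blast
    \<comment> \<open>Some member of \<open>C\<close> exists and contains \<open>I\<close>, hence so
      does the union; no member contains the identity.\<close>
    show "\<Union>C \<in> ?A" if "C \<noteq> {}" and C: "subset.chain ?A C" for C
      using that left_ideal_Union_chain[OF assms(1) C]
      by (auto simp: subset_chain_def)
  qed
  then obtain K where "K \<in> ?A" and "\<forall>L\<in>?A. K \<subseteq> L \<longrightarrow> L = K" ..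
  then have K: "left_ideal K R" "I \<subseteq> K" "\<one>\<^bsub>R\<^esub> \<notin> K"
    and max: "\<And>L. \<lbrakk>left_ideal L R; I \<subseteq> L; \<one>\<^bsub>R\<^esub> \<notin> L; K \<subseteq> L\<rbrakk> \<Longrightarrow> L = K"
    by simp_all
  \<comment> \<open>Maximality within \<open>?A\<close> suffices: a left ideal above
    \<open>K\<close> either omits the identity and lies in \<open>?A\<close>, or contains it and is
    all of \<open>R\<close>.\<close>
  have "maximal_left_ideal K R"
    unfolding maximal_left_ideal_def
    using K max left_ideal_eq_carrier_iff[OF assms(1)] by blast
  then show ?thesis using that K(2) by blast
qed

section \<open>Idempotents in the Jacobson radical\<close>

lemma zero_mem_jacobson_radical: "ring R \<Longrightarrow> \<zero>\<^bsub>R\<^esub> \<in> jacobson_radical R"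
  by (auto simp: jacobson_radical_def maximal_left_ideal_def left_ideal_zero_mem ring.ring_simprules)

text \<open>For \<open>e\<close> in the radical, 1 - e has a left inverse \<open>r\<close>.
  Multiplying r(1 - e) = 1 on the right by \<open>e\<close> gives e = r(e - ee) = 0.\<close>

lemma idempotent_mem_jacobson_radical:
  assumes "ring R" and idem: "idempotent_elem R e" and J: "e \<in> jacobson_radical R"
  shows "e = \<zero>\<^bsub>R\<^esub>"
proof -
  interpret ring R by fact
  have e: "e \<in> carrier R" and ee: "e \<otimes>\<^bsub>R\<^esub> e = e"
    using idem by (auto simp: idempotent_elem_def)
  let ?f = "\<one>\<^bsub>R\<^esub> \<ominus>\<^bsub>R\<^esub> e"
  have f: "?f \<in> carrier R" using e by simp
  let ?I = "{r \<otimes>\<^bsub>R\<^esub> ?f | r. r \<in> carrier R}"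
  have I: "left_ideal ?I R"
  proof (rule left_idealI[OF assms(1)])
    show "?I \<subseteq> carrier R" using f by auto
    show "\<zero>\<^bsub>R\<^esub> \<in> ?I" using f by (force intro!: exI[of _ "\<zero>\<^bsub>R\<^esub>"])
    show "x \<oplus>\<^bsub>R\<^esub> y \<in> ?I" if xy: "x \<in> ?I" "y \<in> ?I" for x y
    proof -
      obtain a b where "a \<in> carrier R" "b \<in> carrier R"
        "x = a \<otimes>\<^bsub>R\<^esub> ?f" "y = b \<otimes>\<^bsub>R\<^esub> ?f"
        using xy by blast
      then have "x \<oplus>\<^bsub>R\<^esub> y = (a \<oplus>\<^bsub>R\<^esub> b) \<otimes>\<^bsub>R\<^esub> ?f" "a \<oplus>\<^bsub>R\<^esub> b \<in> carrier R"
        using l_distr[OF _ _ f] by simp_all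
      then show ?thesis by blast
    qed
    show "r \<otimes>\<^bsub>R\<^esub> x \<in> ?I" if r: "r \<in> carrier R" and x: "x \<in> ?I" for r x
    proof -
      obtain a where "a \<in> carrier R" "x = a \<otimes>\<^bsub>R\<^esub> ?f"
        using x by blast
      then have "r \<otimes>\<^bsub>R\<^esub> x = (r \<otimes>\<^bsub>R\<^esub> a) \<otimes>\<^bsub>R\<^esub> ?f" "r \<otimes>\<^bsub>R\<^esub> a \<in> carrier R"
        using m_assoc[OF _ _ f] r by simp_all
      then show ?thesis by blast
    qed
  qed
  \<comment> \<open>If R(1 - e) were proper, a maximal left ideal above it would contain both 1 - e
    and \<open>e\<close>, hence their sum 1.\<close>
  have "?I = carrier R"
  proof (rule ccontr)
    assume "?I \<noteq> carrier R"
    then obtain K where K: "maximal_left_ideal K R" "?I \<subseteq> K"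
      using ex_maximal_left_ideal[OF assms(1) I] by blast
    have KL: "left_ideal K R" "K \<noteq> carrier R"
      using K(1) by (auto simp: maximal_left_ideal_def)
    have "e \<in> K" using J K(1) by (simp add: jacobson_radical_def)
    moreover have "?f \<in> ?I"
      by (rule CollectI, rule exI[of _ "\<one>\<^bsub>R\<^esub>"]) (use f in simp)
    ultimately have "?f \<oplus>\<^bsub>R\<^esub> e \<in> K" using K(2) by (intro left_ideal_add_mem[OF KL(1)]) auto
    moreover have "?f \<oplus>\<^bsub>R\<^esub> e = \<one>\<^bsub>R\<^esub>" using e by (simp add: minus_eq a_assoc l_neg)
    ultimately show False using KL left_ideal_eq_carrier_iff[OF assms(1)] by simp
  qed
  then obtain r where r: "r \<in> carrier R" "\<one>\<^bsub>R\<^esub> = r \<otimes>\<^bsub>R\<^esub> ?f"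
    using one_closed by blast
  have fe: "?f \<otimes>\<^bsub>R\<^esub> e = \<zero>\<^bsub>R\<^esub>"
    using e ee by (simp add: minus_eq l_distr l_minus r_neg)
  have "e = r \<otimes>\<^bsub>R\<^esub> ?f \<otimes>\<^bsub>R\<^esub> e" using e r(2) by (metis l_one)
  also have "\<dots> = r \<otimes>\<^bsub>R\<^esub> (?f \<otimes>\<^bsub>R\<^esub> e)" by (rule m_assoc[OF r(1) f e])
  also have "\<dots> = \<zero>\<^bsub>R\<^esub>" using fe r(1) by simp
  finally show ?thesis .
qed

section \<open>Functionals on a left module\<close>

context left_module
begin

lemma dual_closed: "\<lbrakk>q \<in> module_dual R M; m \<in> carrier M\<rbrakk> \<Longrightarrow> q m \<in> carrier R"
  by (auto simp: module_dual_def hom_def)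

lemma dual_add:
  "\<lbrakk>q \<in> module_dual R M; m \<in> carrier M; n \<in> carrier M\<rbrakk> \<Longrightarrow> q (m \<oplus>\<^bsub>M\<^esub> n) = q m \<oplus> q n"
  by (auto simp: module_dual_def hom_def)

lemma dual_smult:
  "\<lbrakk>q \<in> module_dual R M; r \<in> carrier R; m \<in> carrier M\<rbrakk> \<Longrightarrow> q (r \<odot>\<^bsub>M\<^esub> m) = r \<otimes> q m"
  by (auto simp: module_dual_def)

lemma dual_zero:
  assumes "q \<in> module_dual R M"
  shows "q \<zero>\<^bsub>M\<^esub> = \<zero>"
proof -
  have "q \<zero>\<^bsub>M\<^esub> \<oplus> q \<zero>\<^bsub>M\<^esub> = q \<zero>\<^bsub>M\<^esub>"
    using dual_add[OF assms M.zero_closed M.zero_closed] by simp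
  then show ?thesis
    using dual_closed[OF assms M.zero_closed] by (simp add: R.add.r_cancel_one)
qed

lemma dual_minus:
  assumes q: "q \<in> module_dual R M" and m: "m \<in> carrier M" and n: "n \<in> carrier M"
  shows "q (m \<ominus>\<^bsub>M\<^esub> n) = q m \<ominus> q n"
proof -
  have "q (m \<ominus>\<^bsub>M\<^esub> n) \<oplus> q n = q ((m \<ominus>\<^bsub>M\<^esub> n) \<oplus>\<^bsub>M\<^esub> n)"
    using dual_add[OF q _ n] m n by simp
  also have "(m \<ominus>\<^bsub>M\<^esub> n) \<oplus>\<^bsub>M\<^esub> n = m"
    using m n by (simp add: M.minus_eq M.a_assoc M.l_neg)
  finally have "q m = q (m \<ominus>\<^bsub>M\<^esub> n) \<oplus> q n" by simp
  then show ?thesis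
    using dual_closed[OF q] m n by (simp add: R.minus_eq R.a_assoc R.r_neg)
qed

text \<open>This is the right action of \<open>R\<close> on the dual. The scalar must stand on the
  right, so that associativity keeps the map left linear over a noncommutative ring.\<close>

lemma dual_right_mult:
  assumes q: "q \<in> module_dual R M" and r: "r \<in> carrier R"
  shows "(\<lambda>m. q m \<otimes> r) \<in> module_dual R M"
  using assms dual_closed[OF q]
  by (auto simp: module_dual_def hom_def R.l_distr R.m_assoc)

text \<open>Applying any functional \<open>p\<close> to the equation for \<open>m\<close> yields
  \<open>p m = q m \<otimes> p m\<close>. The case \<open>p = q\<close> is idempotence, and the
  general case puts all values into the right ideal generated by \<open>q m\<close>. Right multiples
  of \<open>q\<close> attain every element of that ideal.\<close>

lemma regular_idempotent:
  assumes q: "q \<in> module_dual R M" and m: "m \<in> carrier M" and eq: "m = q m \<odot>\<^bsub>M\<^esub> m"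
  shows "idempotent_elem R (q m)" and "dual_values R M m = q m <# carrier R"
proof -
  have absorb: "p m = q m \<otimes> p m" if "p \<in> module_dual R M" for p
    using dual_smult[OF that dual_closed[OF q m] m] arg_cong[OF eq, of p] by (rule trans[rotated])
  then show "idempotent_elem R (q m)"
    using q m dual_closed by (simp add: idempotent_elem_def flip: absorb)
  show "dual_values R M m = q m <# carrier R"
  proof
    show "dual_values R M m \<subseteq> q m <# carrier R"
      using absorb dual_closed m by (auto simp: dual_values_def l_coset_def)
    show "q m <# carrier R \<subseteq> dual_values R M m"
      using dual_right_mult[OF q] by (force simp: dual_values_def l_coset_def)
  qed
qed

section \<open>Implications between regularity and the torsionless conditions\<close>

lemma regular_imp_J_torsionless:
  assumes "regular_module R M"
  shows "J_torsionless R M"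
proof -
  have "m = \<zero>\<^bsub>M\<^esub>" if m: "m \<in> carrier M" and J: "dual_values R M m \<subseteq> jacobson_radical R" for m
  proof -
    obtain q where q: "q \<in> module_dual R M" and eq: "m = q m \<odot>\<^bsub>M\<^esub> m"
      using assms m by (auto simp: regular_module_def)
    have "q m \<in> jacobson_radical R" using q J by (auto simp: dual_values_def)
    then have zero: "q m = \<zero>"
      using idempotent_mem_jacobson_radical[OF R.ring_axioms regular_idempotent(1)[OF q m eq]]
      by simp
    \<comment> \<open>That the zero scalar kills \<open>m\<close> is not an axiom; it follows from 0
      + 0 = 0 by cancellation.\<close>
    have "\<zero> \<odot>\<^bsub>M\<^esub> m \<oplus>\<^bsub>M\<^esub> \<zero> \<odot>\<^bsub>M\<^esub> m = \<zero> \<odot>\<^bsub>M\<^esub> m"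
      using smult_l_distr[OF R.zero_closed R.zero_closed m] by simp
    then have "\<zero> \<odot>\<^bsub>M\<^esub> m = \<zero>\<^bsub>M\<^esub>"
      using smult_closed[OF R.zero_closed m] by (simp add: M.add.r_cancel_one)
    then show ?thesis using eq zero by metis
  qed
  \<comment> \<open>\<open>J_torsionless\<close> is an equality of sets, so the zero vector must
    also be shown to belong.\<close>
  moreover have "dual_values R M \<zero>\<^bsub>M\<^esub> \<subseteq> jacobson_radical R"
    using zero_mem_jacobson_radical[OF R.ring_axioms] by (auto simp: dual_values_def dual_zero)
  ultimately show ?thesis by (auto simp: J_torsionless_def)
qed

text \<open>The radical contains 0, so a value outside the radical is nonzero.\<close>

lemma J_torsionless_imp_torsionless:
  assumes "J_torsionless R M"
  shows "torsionless R M"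
  unfolding torsionless_def
proof (intro ballI impI)
  fix m assume m: "m \<in> carrier M" "m \<noteq> \<zero>\<^bsub>M\<^esub>"
  then have "m \<notin> {m \<in> carrier M. dual_values R M m \<subseteq> jacobson_radical R}"
    using assms by (simp only: J_torsionless_def) simp
  then have "\<not> dual_values R M m \<subseteq> jacobson_radical R"
    using m(1) by simp
  then show "\<exists>q\<in>module_dual R M. q m \<noteq> \<zero>"
    using zero_mem_jacobson_radical[OF R.ring_axioms] by (auto simp: dual_values_def)
qed

lemma torsionless_imp_regular:
  assumes tl: "torsionless R M"
    and idem: "\<And>m. m \<in> carrier M \<Longrightarrow>
      \<exists>e. idempotent_elem R e \<and> dual_values R M m = e <# carrier R"
  shows "regular_module R M"
  unfolding regular_module_def
proof
  fix m assume m: "m \<in> carrier M"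
  obtain e where e: "e \<in> carrier R" "e \<otimes> e = e" and vals: "dual_values R M m = e <# carrier R"
    using idem[OF m] by (auto simp: idempotent_elem_def)
  \<comment> \<open>Since \<open>e\<close> lies in eR, it is itself a value of some functional at
    \<open>m\<close>; that functional is the witness for regularity.\<close>
  have "e \<in> e <# carrier R" using e by (force simp: l_coset_def)
  then obtain q where q: "q \<in> module_dual R M" and eq: "e = q m"
    unfolding vals[symmetric] by (auto simp: dual_values_def)
  have em: "e \<odot>\<^bsub>M\<^esub> m \<in> carrier M" using smult_closed e m by simp
  have "p (m \<ominus>\<^bsub>M\<^esub> e \<odot>\<^bsub>M\<^esub> m) = \<zero>" if p: "p \<in> module_dual R M" for p
  proof -
    have "p m \<in> e <# carrier R" unfolding vals[symmetric] using p by (auto simp: dual_values_def)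
    then obtain r where r: "r \<in> carrier R" "p m = e \<otimes> r" by (auto simp: l_coset_def)
    \<comment> \<open>Left multiplication by an idempotent \<open>e\<close> fixes every element of
      eR.\<close>
    then have "e \<otimes> p m = p m" using e by (simp flip: R.m_assoc)
    then show ?thesis
      using dual_minus[OF p m em] dual_smult[OF p e(1) m] dual_closed[OF p m]
      by (simp add: R.minus_eq R.r_neg)
  qed
  then have "m \<ominus>\<^bsub>M\<^esub> e \<odot>\<^bsub>M\<^esub> m = \<zero>\<^bsub>M\<^esub>"
    using tl M.minus_closed[OF m em] unfolding torsionless_def by blast
  moreover have "(m \<ominus>\<^bsub>M\<^esub> e \<odot>\<^bsub>M\<^esub> m) \<oplus>\<^bsub>M\<^esub> e \<odot>\<^bsub>M\<^esub> m = m"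
    using m em by (simp add: M.minus_eq M.a_assoc M.l_neg)
  ultimately have "m = e \<odot>\<^bsub>M\<^esub> m" using em by simp
  then show "\<exists>q\<in>module_dual R M. m = q m \<odot>\<^bsub>M\<^esub> m" using q eq by blast
qed

end

theorem theorem3p15:
  fixes R :: "('a, 'r) ring_scheme" and M :: "('a, 'b, 'm) module_scheme"
  assumes "left_module R M"
  shows "(regular_module R M \<longleftrightarrow>
            J_torsionless R M \<and>
            (\<forall>m\<in>carrier M. \<exists>e. idempotent_elem R e \<and> dual_values R M m = e <#\<^bsub>R\<^esub> carrier R))
       \<and> (regular_module R M \<longleftrightarrow>
            torsionless R M \<and>
            (\<forall>m\<in>carrier M. \<exists>e. idempotent_elem R e \<and> dual_values R M m = e <#\<^bsub>R\<^esub> carrier R))"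
proof -
  interpret left_module R M by fact
  let ?idem = "\<forall>m\<in>carrier M. \<exists>e. idempotent_elem R e \<and> dual_values R M m = e <#\<^bsub>R\<^esub> carrier R"
  have idem: ?idem if reg: "regular_module R M"
  proof
    fix m assume m: "m \<in> carrier M"
    then obtain q where "q \<in> module_dual R M" "m = q m \<odot>\<^bsub>M\<^esub> m"
      using reg unfolding regular_module_def by blast
    then show "\<exists>e. idempotent_elem R e \<and> dual_values R M m = e <#\<^bsub>R\<^esub> carrier R"
      using regular_idempotent m by blast
  qed
  have "regular_module R M" if "torsionless R M" ?idem
    using torsionless_imp_regular[OF that(1)] that(2) by simp
  \<comment> \<open>Both equivalences follow from the cycle regular, J-torsionless, torsionless,
    regular, with the idempotent condition carried along.\<close>
  then show ?thesis
    using idem regular_imp_J_torsionless J_torsionless_imp_torsionless by argo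
qed

end
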